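(* Let $\mathcal{H}$ be a real Hilbert space. Let $f \in \mathcal{F}_{\mu_f, L_f}$, $g \in \mathcal{F}_{\mu_g, L_g}$, and $h \in \mathcal{F}_{\mu_h, L_h}$ be functions on $\mathcal{H}$, where $$0 \le \mu_f < L_f \le \infty, \quad 0 \le \mu_g < L_g \le \infty, \quad 0 \le \mu_h < L_h < \infty.$$ Let $\lambda > 0$ and $\alpha > 0$. With the convention $r/\infty = 0$ for every real number $r$ (so $\frac{1}{1+\alpha L_f} = 0$ if $L_f = \infty$, and likewise for $L_g$), write $$d = \max\{|2 - \lambda - \alpha\mu_h|, |2 - \lambda - \alpha L_h|\},$$ $$C_f = \frac{1}{2}\left( \frac{1}{1 + \alpha \mu_f} + \frac{1}{1 + \alpha L_f} \right), \quad C_g = \frac{1}{2}\left( \frac{1}{1 + \alpha \mu_g} + \frac{1}{1 + \alpha L_g} \right),$$ $$R_f = \frac{1}{2}\left( \frac{1}{1 + \alpha \mu_f} - \frac{1}{1 + \alpha L_f} \right), \quad R_g = \frac{1}{2}\left( \frac{1}{1 + \alpha \mu_g} - \frac{1}{1 + \alpha L_g} \right).$$ Let $\mathbb{T} = \mathbb{T}_{\partial f, \partial g, \nabla h, \alpha, \lambda}\colon \mathcal{H} \to \mathcal{H}$ be the subdifferential Davis--Yin splitting operator. (1) If $\lambda < 1/C_f$, then $\mathbb{T}$ is $\rho_f$-Lipschitz, where $\rho_f \ge 0$ is given by $$\rho_f^2 = \left( 1 - \lambda \frac{C_f^2 - R_f^2}{C_f} \right) \max\left\{ \left( 1 - \frac{\lambda}{1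 + \alpha\mu_g} \right)^2 + \frac{\lambda d^2}{1 / C_f - \lambda} \left( \frac{1}{1 + \alpha\mu_g} \right)^2,\ \left( 1 - \frac{\lambda}{1 + \alpha L_g} \right)^2 + \frac{\lambda d^2}{1 / C_f - \lambda} \left( \frac{1}{1 + \alpha L_g} \right)^2 \right\}.$$ (2) Symmetrically, if $\lambda < 1/C_g$, then $\mathbb{T}$ is $\rho_g$-Lipschitz, where $\rho_g \ge 0$ is given by $$\rho_g^2 = \left( 1 - \lambda \frac{C_g^2 - R_g^2}{C_g} \right) \max\left\{ \left( 1 - \frac{\lambda}{1 + \alpha\mu_f} \right)^2 + \frac{\lambda d^2}{1 / C_g - \lambda} \left( \frac{1}{1 + \alpha\mu_f} \right)^2,\ \left( 1 - \frac{\lambda}{1 + \alpha L_f} \right)^2 + \frac{\lambda d^2}{1 / C_g - \lambda} \left( \frac{1}{1 + \alpha L_f} \right)^2 \right\}.$$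
   Context: $\mathcal{H}$ is a real Hilbert space with inner product $\langle\cdot,\cdot\rangle$ and norm $\|\cdot\|$. Functions on $\mathcal{H}$ are extended real-valued, $f\colon\mathcal{H}\to\mathbb{R}\cup\{\pm\infty\}$; $f$ is CCP if it is convex, closed (lower semicontinuous), and proper. For $\mu, L \in (0,\infty)$: $f$ is $\mu$-strongly convex if $f - \frac{\mu}{2}\|\cdot\|^2$ is convex; $f$ is $L$-smooth if it is (finite and) differentiable on $\mathcal{H}$ with $L$-Lipschitz continuous gradient. Function classes, for $\mu, L\in(0,\infty)$: - $\mathcal{F}_{\mu,L}$: all CCP functions that are $\mu$-strongly convex and $L$-smooth; - $\mathcal{F}_{0,L}$: all CCP functions that are $L$-smooth; - $\mathcal{F}_{\mu,\infty}$: all CCP functions that are $\mu$-strongly convex; - $\mathcal{F}_{0,\infty}$: all CCP functions. For a CCP function $f$ and $\alpha>0$, the proximal operator is $\mathrm{Prox}_{\alpha f}(x) = \operatorname{argmin}_{y\in\mathcal{H}}\{\alpha f(y) + \frac12\|x-y\|^2\}$, which equals the resolvent $(\mathbb{I}+\alpha\partial f)^{-1}$, where $\partial f$ is the convex subdifferential and $\mathbb{I}$ is the identity map. For step size $\alpha>0$ and averaging parameter $\lambda>0$, the subdifferential Davis--Yin splitting (DYS) operator is $$\mathbb{T}_{\partial f,\partial g,\nabla h,\alpha,\lambda} = \mathbb{I} - \lambda\,\mathrm{Prox}_{\alpha g} + \lambda\,\mathrm{Prox}_{\alpha f}\,(2\,\mathrm{Prox}_{\alpha g} - \mathbb{I}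 - \alpha\nabla h\,\mathrm{Prox}_{\alpha g}),$$ where juxtaposition of operators denotes composition; that is, $\mathbb{T}x = x - \lambda p + \lambda\,\mathrm{Prox}_{\alpha f}(2p - x - \alpha\nabla h(p))$ with $p=\mathrm{Prox}_{\alpha g}(x)$. An operator $\mathbb{T}\colon\mathcal{H}\to\mathcal{H}$ is $\rho$-Lipschitz if $\|\mathbb{T}x-\mathbb{T}y\|\le\rho\|x-y\|$ for all $x,y\in\mathcal{H}$. *)

theory Defs
  imports "HOL-Analysis.Analysis"
begin

(* In ereal, \<infinity> + -\<infinity> = \<infinity>, so the inequality has content only where its right-hand
   side is not of the form \<infinity> - \<infinity>, as usual for extended real-valued functions. *)
definition ext_convex :: "('a::real_vector \<Rightarrow> ereal) \<Rightarrow> bool" where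
  "ext_convex f \<longleftrightarrow>
     (\<forall>x y. \<forall>t\<in>{0<..<1::real}.
        f ((1 - t) *\<^sub>R x + t *\<^sub>R y) \<le> ereal (1 - t) * f x + ereal t * f y)"

definition lower_semicont :: "('a::topological_space \<Rightarrow> ereal) \<Rightarrow> bool" where
  "lower_semicont f \<longleftrightarrow> (\<forall>x. f x \<le> Liminf (at x) f)"

definition proper_fun :: "('a \<Rightarrow> ereal) \<Rightarrow> bool" where
  "proper_fun f \<longleftrightarrow> (\<forall>x. f x \<noteq> -\<infinity>) \<and> (\<exists>x. f x \<noteq> \<infinity>)"

definition ccp :: "('a::real_normed_vector \<Rightarrow> ereal) \<Rightarrow> bool" where
  "ccp f \<longleftrightarrow> ext_convex f \<and> lower_semicont f \<and> proper_fun f"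

definition strongly_convex :: "real \<Rightarrow> ('a::real_normed_vector \<Rightarrow> ereal) \<Rightarrow> bool" where
  "strongly_convex \<mu> f \<longleftrightarrow> ext_convex (\<lambda>x. f x - ereal (\<mu> / 2 * (norm x)\<^sup>2))"

definition smooth_fun :: "real \<Rightarrow> ('a::real_inner \<Rightarrow> ereal) \<Rightarrow> bool" where
  "smooth_fun L f \<longleftrightarrow>
     (\<forall>x. \<bar>f x\<bar> \<noteq> \<infinity>) \<and>
     (\<exists>G. (\<forall>x. GDERIV (\<lambda>y. real_of_ereal (f y)) x :> G x) \<and> L-lipschitz_on UNIV G)"

(* \<mu> = 0 and L = \<infinity> mean that no strong convexity, respectively smoothness, is required. *)
definition fun_class :: "real \<Rightarrow> ereal \<Rightarrow> ('a::real_inner \<Rightarrow> ereal) set" where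
  "fun_class \<mu> L =
     {f. ccp f \<and> (0 < \<mu> \<longrightarrow> strongly_convex \<mu> f) \<and>
         (L < \<infinity> \<longrightarrow> smooth_fun (real_of_ereal L) f)}"

(* Meaningful only where f is finite near x and differentiable at x. *)
definition gradient :: "('a::real_inner \<Rightarrow> ereal) \<Rightarrow> 'a \<Rightarrow> 'a" where
  "gradient f x = (THE D. GDERIV (\<lambda>y. real_of_ereal (f y)) x :> D)"

(* Prox of \<alpha> f; for ccp f on a Hilbert space and \<alpha> > 0 the minimizer exists and is unique. *)
definition prox :: "real \<Rightarrow> ('a::real_inner \<Rightarrow> ereal) \<Rightarrow> 'a \<Rightarrow> 'a" where
  "prox \<alpha> f x = arg_min (\<lambda>y. ereal \<alpha> * f y + ereal (1 / 2 * (norm (x - y))\<^sup>2)) (\<lambda>_. True)"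

definition dys_operator ::
    "('a::real_inner \<Rightarrow> ereal) \<Rightarrow> ('a \<Rightarrow> ereal) \<Rightarrow> ('a \<Rightarrow> ereal) \<Rightarrow> real \<Rightarrow> real \<Rightarrow> 'a \<Rightarrow> 'a" where
  "dys_operator f g h \<alpha> lam x =
     x - lam *\<^sub>R prox \<alpha> g x
       + lam *\<^sub>R prox \<alpha> f (2 *\<^sub>R prox \<alpha> g x - x - \<alpha> *\<^sub>R gradient h (prox \<alpha> g x))"

(* 1 / (1 + \<alpha> L), which is 0 for L = \<infinity> since 1 / \<infinity> = 0 in ereal. *)
definition res_coeff :: "real \<Rightarrow> ereal \<Rightarrow> real" where
  "res_coeff \<alpha> L = real_of_ereal (1 / (1 + ereal \<alpha> * L))"

end

theory Submission
  imports Defs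
begin

text \<open>For two arguments let \<open>X\<close>, \<open>P\<close>, \<open>H\<close>, \<open>Q\<close> be the differences of the points, of the inner
  resolvents, of the gradients of \<open>h\<close> and of the outer resolvents. The difference of the iterates is
  \<open>A + \<lambda> Q\<close> with \<open>A = X - \<lambda> P\<close>, and \<open>Q\<close> responds to \<open>Z = D - A\<close> with
  \<open>D = (2 - \<lambda>) P - \<alpha> H\<close>, where \<open>\<parallel>D\<parallel> \<le> d \<parallel>P\<parallel>\<close> by cocoercivity. Each resolvent confines its output
  difference to the ball with diameter from \<open>X / (1 + \<alpha> L)\<close> to \<open>X / (1 + \<alpha> \<mu>)\<close>.
  For \<open>\<rho>\<^sub>f\<close> one first maximizes over \<open>Q\<close> in its ball for fixed \<open>A\<close>, \<open>D\<close>, and then over \<open>P\<close>.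
  The bound \<open>\<rho>\<^sub>g\<close> is the same estimate for the adjoint map: pairing \<open>A + \<lambda> Q\<close> with a vector \<open>v\<close>
  moves the outer resolvent onto \<open>v\<close>, and Cauchy--Schwarz separates the two factors.\<close>

subsection \<open>Sector conditions\<close>

text \<open>By Thales this is the closed ball with diameter from \<open>l *\<^sub>R x\<close> to
  \<open>u *\<^sub>R x\<close>. The product form treats \<open>l = 0\<close>, which
  \<open>L = \<infinity>\<close> produces, like any other value.\<close>

definition sector :: "real \<Rightarrow> real \<Rightarrow> 'a::real_inner \<Rightarrow> 'a \<Rightarrow> bool" where
  "sector l u x y \<longleftrightarrow> 0 \<le> (y - l *\<^sub>R x) \<bullet> (u *\<^sub>R x - y)"

lemma norm_diff_scaleR_sq:
  fixes x y :: "'a::real_inner"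
  shows "(norm (x - c *\<^sub>R y))\<^sup>2 = (norm x)\<^sup>2 - 2 * c * (x \<bullet> y) + c\<^sup>2 * (norm y)\<^sup>2"
  unfolding power2_norm_eq_inner
  by (simp add: inner_diff_left inner_diff_right inner_commute power2_eq_square algebra_simps)

lemma sector_expand:
  "(y - l *\<^sub>R x) \<bullet> (u *\<^sub>R x - y) = (l + u) * (x \<bullet> y) - (norm y)\<^sup>2 - l * u * (norm x)\<^sup>2"
  by (simp add: inner_diff_left inner_diff_right inner_commute power2_norm_eq_inner algebra_simps)

lemma sector_iff_ball:
  "sector l u x y \<longleftrightarrow>
    (norm (y - (1 / 2 * (u + l)) *\<^sub>R x))\<^sup>2 \<le> (1 / 2 * (u - l))\<^sup>2 * (norm x)\<^sup>2"
proof -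
  have "(1 / 2 * (u - l))\<^sup>2 * (norm x)\<^sup>2 - (norm (y - (1 / 2 * (u + l)) *\<^sub>R x))\<^sup>2
      = (y - l *\<^sub>R x) \<bullet> (u *\<^sub>R x - y)"
    unfolding sector_expand power2_norm_eq_inner
    by (simp add: inner_diff_left inner_diff_right inner_commute power2_eq_square field_simps)
  then show ?thesis
    by (simp add: sector_def) linarith
qed

text \<open>A ball projects orthogonally into its diameter. In formulas, \<open>u - l\<close> times
  each gap is a square plus the sector product.\<close>

lemma sector_inner_bounds:
  assumes "sector l u x y" "l < u"
  shows "l * (norm x)\<^sup>2 \<le> x \<bullet> y" "x \<bullet> y \<le> u * (norm x)\<^sup>2"
proof -
  have "0 \<le> (norm (y - l *\<^sub>R x))\<^sup>2" "0 \<le> (norm (u *\<^sub>R x - y))\<^sup>2"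
    by simp_all
  moreover have "(u - l) * (x \<bullet> y - l * (norm x)\<^sup>2)
      = (norm (y - l *\<^sub>R x))\<^sup>2 + (y - l *\<^sub>R x) \<bullet> (u *\<^sub>R x - y)"
    and "(u - l) * (u * (norm x)\<^sup>2 - x \<bullet> y)
      = (norm (u *\<^sub>R x - y))\<^sup>2 + (y - l *\<^sub>R x) \<bullet> (u *\<^sub>R x - y)"
    by (simp_all add: power2_norm_eq_inner inner_diff_left inner_diff_right inner_commute
        algebra_simps)
  ultimately have "0 \<le> (u - l) * (x \<bullet> y - l * (norm x)\<^sup>2)"
    and "0 \<le> (u - l) * (u * (norm x)\<^sup>2 - x \<bullet> y)"
    using assms(1) by (simp_all add: sector_def)
  then show "l * (norm x)\<^sup>2 \<le> x \<bullet> y" "x \<bullet> y \<le> u * (norm x)\<^sup>2"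
    using assms(2) by (simp_all add: zero_le_mult_iff)
qed

text \<open>Bounding \<open>norm y\<close> by the sector product leaves a function affine in
  \<open>x \<bullet> y\<close>, which ranges over an interval. Its maximum sits at an end, and the
  ends correspond to \<open>y = u *\<^sub>R x\<close> and \<open>y = l *\<^sub>R x\<close>.\<close>

lemma sector_quadratic_bound:
  assumes "sector l u x y" "l < u" "0 \<le> e"
  shows "(norm (x - c *\<^sub>R y))\<^sup>2 + e * (norm y)\<^sup>2
    \<le> max ((1 - c * u)\<^sup>2 + e * u\<^sup>2) ((1 - c * l)\<^sup>2 + e * l\<^sup>2) * (norm x)\<^sup>2" (is "?A \<le> ?M * _")
proof -
  define N J k where "N = (norm x)\<^sup>2" and "J = x \<bullet> y" and "k = c\<^sup>2 + e"
  have k: "0 \<le> k" using assms by (simp add: k_def)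
  have J: "l * N \<le> J" "J \<le> u * N"
    using sector_inner_bounds[OF assms(1,2)] by (simp_all add: N_def J_def)
  have "(norm y)\<^sup>2 \<le> (l + u) * J - l * u * N"
    using assms(1) by (simp add: sector_def sector_expand N_def J_def)
  then have "k * (norm y)\<^sup>2 \<le> k * ((l + u) * J - l * u * N)"
    using k by (rule mult_left_mono)
  moreover have "?A = N - 2 * c * J + k * (norm y)\<^sup>2"
    by (simp add: N_def J_def k_def norm_diff_scaleR_sq algebra_simps)
  ultimately have "?A \<le> N - 2 * c * J + k * ((l + u) * J - l * u * N)" by simp
  then have "(u - l) * ?A \<le> (u - l) * (N - 2 * c * J + k * ((l + u) * J - l * u * N))"
    using assms(2) by (intro mult_left_mono) auto
  \<comment> \<open>Linear interpolation between the two end values, multiplied by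
    \<open>u - l\<close> to clear the denominators of the weights.\<close>
  also have "\<dots> = ((1 - c * u)\<^sup>2 + e * u\<^sup>2) * (J - l * N) + ((1 - c * l)\<^sup>2 + e * l\<^sup>2) * (u * N - J)"
    by (simp add: k_def power2_eq_square algebra_simps)
  also have "\<dots> \<le> ?M * (J - l * N) + ?M * (u * N - J)"
    using J by (intro add_mono mult_right_mono) auto
  also have "\<dots> = (u - l) * (?M * N)" by (simp add: algebra_simps)
  finally show ?thesis using assms(2) by (simp add: N_def)
qed

section \<open>Estimates for one resolvent step\<close>

lemma norm_add_sq_le_Young:
  fixes x y :: "'a::real_inner"
  assumes "0 < t"
  shows "(norm (x + y))\<^sup>2 \<le> (1 + t) * (norm x)\<^sup>2 + (1 + 1 / t) * (norm y)\<^sup>2"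
proof -
  have "0 \<le> (norm (t *\<^sub>R x - y))\<^sup>2 / t" using assms by simp
  also have "\<dots> = t * (norm x)\<^sup>2 - 2 * (x \<bullet> y) + (norm y)\<^sup>2 / t"
    using assms by (simp add: power2_norm_eq_inner inner_diff_left inner_diff_right
        inner_commute field_simps)
  finally show ?thesis
    by (simp add: power2_norm_eq_inner inner_add_left inner_add_right inner_commute algebra_simps)
qed

text \<open>This identity absorbs \<open>Z\<close> in the outer step, puts strong convexity into its
  \<open>t * (1 - t)\<close> form, and drives the midpoint estimate for proximal points.\<close>

lemma norm_sq_convex_combination:
  fixes x y :: "'a::real_inner"
  shows "(norm ((1 - a) *\<^sub>R x + a *\<^sub>R y))\<^sup>2
    = (1 - a) * (norm x)\<^sup>2 + a * (norm y)\<^sup>2 - a * (1 - a) * (norm (x - y))\<^sup>2"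
  by (simp add: power2_norm_eq_inner inner_add_left inner_add_right inner_diff_left
      inner_diff_right inner_commute algebra_simps)

text \<open>Splitting \<open>Q\<close> into the centre \<open>C *\<^sub>R Z\<close> of its ball and
  a remainder \<open>W\<close> turns the step into a convex combination of \<open>A\<close> and
  \<open>D\<close> plus \<open>c *\<^sub>R W\<close>. Young's inequality separates the two, and the
  defect \<open>a * (1 - a) * (norm Z)\<^sup>2\<close> of the combination pays for
  \<open>W\<close>.\<close>

lemma sector_step_bound_outer:
  fixes A D Q :: "'a::real_inner" and l u c :: real
  defines "C \<equiv> 1 / 2 * (u + l)" and "R \<equiv> 1 / 2 * (u - l)"
  assumes "sector l u (D - A) Q" "0 \<le> l" "l < u" "0 < c" "c < 1 / C"
  shows "(norm (A + c *\<^sub>R Q))\<^sup>2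
    \<le> (1 - c * ((C\<^sup>2 - R\<^sup>2) / C)) * ((norm A)\<^sup>2 + c / (1 / C - c) * (norm D)\<^sup>2)"
proof -
  have C: "0 < C" and R: "0 < R" using assms by (simp_all add: C_def R_def)
  \<comment> \<open>\<open>t\<close> solves
    \<open>(1 + 1 / t) * (c * R)\<^sup>2 = (1 + t) * (a * (1 - a))\<close>, so that the terms in
    \<open>Z\<close> cancel exactly. It is positive because \<open>l < u\<close> and
    \<open>c < 1 / C\<close>.\<close>
  define a t where "a = c * C" and "t = (c * R)\<^sup>2 / (a * (1 - a))"
  have a: "0 < a" "a < 1" using assms(6,7) C by (simp_all add: a_def field_simps)
  have t: "0 < t" using a R assms(6) by (simp add: t_def)
  define Z W n where "Z = D - A" and "W = Q - C *\<^sub>R Z" and "n = (1 - a) *\<^sub>R A + a *\<^sub>R D"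
  have W: "(norm W)\<^sup>2 \<le> R\<^sup>2 * (norm Z)\<^sup>2"
    using assms(3) by (simp add: sector_iff_ball W_def Z_def C_def R_def)
  have "A + c *\<^sub>R Q = n + c *\<^sub>R W"
    by (simp add: n_def W_def Z_def a_def algebra_simps)
  then have "(norm (A + c *\<^sub>R Q))\<^sup>2 \<le> (1 + t) * (norm n)\<^sup>2 + (1 + 1 / t) * (norm (c *\<^sub>R W))\<^sup>2"
    by (simp only: norm_add_sq_le_Young[OF t])
  also have "\<dots> \<le> (1 + t) * (norm n)\<^sup>2 + (1 + 1 / t) * ((c * R)\<^sup>2 * (norm Z)\<^sup>2)"
    using W t assms(6)
    by (intro add_left_mono mult_left_mono) (auto simp: power_mult_distrib intro!: mult_left_mono)
  also have "(1 + 1 / t) * ((c * R)\<^sup>2 * (norm Z)\<^sup>2) = (1 + t) * (a * (1 - a) * (norm Z)\<^sup>2)"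
  proof -
    have *: "(c * R)\<^sup>2 = t * (a * (1 - a))" using a by (simp add: t_def)
    show ?thesis unfolding * using t by (simp add: field_simps)
  qed
  also have "(1 + t) * (norm n)\<^sup>2 + (1 + t) * (a * (1 - a) * (norm Z)\<^sup>2)
      = (1 + t) * ((1 - a) * (norm A)\<^sup>2 + a * (norm D)\<^sup>2)"
    unfolding n_def norm_sq_convex_combination Z_def by (simp add: norm_minus_commute algebra_simps)
  also have "\<dots> = ((1 + t) * (1 - a)) * ((norm A)\<^sup>2 + a / (1 - a) * (norm D)\<^sup>2)"
    using a by (simp add: field_simps)
  also have "(1 + t) * (1 - a) = 1 - c * ((C\<^sup>2 - R\<^sup>2) / C)"
    using a C assms(6) by (simp add: t_def a_def field_simps power2_eq_square)
  also have "a / (1 - a) = c / (1 / C - c)"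
    using C by (simp add: a_def field_simps)
  finally show ?thesis .
qed

text \<open>The gap between the two sides is exactly \<open>c / C\<close> times the sector product.
  The weight of \<open>P\<close> is chosen to cancel the quadratic term of the expanded
  norm.\<close>

lemma sector_step_bound_inner:
  fixes X P :: "'a::real_inner" and l u c :: real
  defines "C \<equiv> 1 / 2 * (u + l)" and "R \<equiv> 1 / 2 * (u - l)"
  assumes "sector l u X P" "0 \<le> l" "l < u" "0 < c"
  shows "(norm (X - c *\<^sub>R P))\<^sup>2 + c * (1 / C - c) * (norm P)\<^sup>2
    \<le> (1 - c * ((C\<^sup>2 - R\<^sup>2) / C)) * (norm X)\<^sup>2"
proof -
  have C: "0 < C" using assms by (simp add: C_def)
  have "l + u = 2 * C" "l * u = C\<^sup>2 - R\<^sup>2"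
    by (simp_all add: C_def R_def power2_eq_square field_simps)
  then have "0 \<le> c / C * (2 * C * (X \<bullet> P) - (norm P)\<^sup>2 - (C\<^sup>2 - R\<^sup>2) * (norm X)\<^sup>2)"
    using assms(3,6) C by (simp add: sector_def sector_expand)
  also have "\<dots> = (1 - c * ((C\<^sup>2 - R\<^sup>2) / C)) * (norm X)\<^sup>2
      - ((norm (X - c *\<^sub>R P))\<^sup>2 + c * (1 / C - c) * (norm P)\<^sup>2)"
    unfolding norm_diff_scaleR_sq using C by (simp add: field_simps power2_eq_square)
  finally show ?thesis by simp
qed

text \<open>A stand-in for self-adjointness: if \<open>Q\<close> is the image of \<open>Z\<close> under some
  symmetric operator with spectrum in \<open>[l, u]\<close>, then \<open>V\<close> plays the role of the image of \<open>v\<close>.\<close>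

lemma sector_adjoint:
  fixes Z Q v :: "'a::real_inner"
  assumes "sector l u Z Q" "l \<le> u"
  obtains V where "sector l u v V" "V \<bullet> Z = v \<bullet> Q"
proof -
  define C R W where "C = 1 / 2 * (u + l)" and "R = 1 / 2 * (u - l)" and "W = Q - C *\<^sub>R Z"
  have R: "0 \<le> R" using assms by (simp add: R_def)
  have "(norm W)\<^sup>2 \<le> (R * norm Z)\<^sup>2"
    using assms(1) by (simp add: sector_iff_ball W_def C_def R_def power_mult_distrib power_divide)
  then have W: "norm W \<le> R * norm Z"
    by (rule power2_le_imp_le) (simp add: R)
  \<comment> \<open>The multiple of \<open>Z\<close> with the prescribed product
    \<open>U \<bullet> Z = v \<bullet> W\<close>. If \<open>Z = 0\<close>, division by zero gives
    \<open>U = 0\<close>, which fits because \<open>W = 0\<close> as well.\<close>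
  define U where "U = ((v \<bullet> W) / (norm Z)\<^sup>2) *\<^sub>R Z"
  have "norm U \<le> R * norm v"
  proof (cases "Z = 0")
    case False
    have "\<bar>v \<bullet> W\<bar> \<le> norm v * norm W" by (rule Cauchy_Schwarz_ineq2)
    also have "\<dots> \<le> norm v * (R * norm Z)" using W by (intro mult_left_mono) auto
    finally show ?thesis using False by (simp add: U_def power2_eq_square field_simps)
  qed (simp add: U_def R)
  then have "(norm U)\<^sup>2 \<le> (R * norm v)\<^sup>2" by (intro power_mono) auto
  then have "sector l u v (C *\<^sub>R v + U)"
    by (simp add: sector_iff_ball C_def R_def power_mult_distrib power_divide)
  moreover have "U \<bullet> Z = v \<bullet> W"
    using W by (cases "Z = 0") (simp_all add: U_def power2_norm_eq_inner)
  then have "(C *\<^sub>R v + U) \<bullet> Z = v \<bullet> Q"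
    by (simp add: W_def inner_add_left inner_diff_right)
  ultimately show thesis using that by blast
qed

text \<open>Cauchy-Schwarz in the plane, from the Lagrange identity: the gap of the squares is
  \<open>(a * d - c * b)\<^sup>2\<close>.\<close>

lemma add_mult_le_sqrt_mult_sqrt:
  fixes a b c d :: real
  shows "a * b + c * d \<le> sqrt (a\<^sup>2 + c\<^sup>2) * sqrt (b\<^sup>2 + d\<^sup>2)"
proof -
  have "(a * b + c * d)\<^sup>2 \<le> (a\<^sup>2 + c\<^sup>2) * (b\<^sup>2 + d\<^sup>2)"
    using sum_squares_ge_zero[of "a * d - c * b" 0]
    by (simp add: power2_eq_square algebra_simps)
  then have "\<bar>a * b + c * d\<bar> \<le> sqrt ((a\<^sup>2 + c\<^sup>2) * (b\<^sup>2 + d\<^sup>2))"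
    by (rule real_le_rsqrt[of "\<bar>_\<bar>", unfolded power2_abs])
  then show ?thesis by (simp add: real_sqrt_mult)
qed

text \<open>Pairing \<open>v = A + c *\<^sub>R Q\<close> with itself and passing from
  \<open>Q\<close> to \<open>V\<close> leaves \<open>A\<close> against
  \<open>v - c *\<^sub>R V\<close> and \<open>D\<close> against \<open>V\<close>; the quadratic
  bound controls these two partners together. The weight \<open>e\<close> stays free so that it can
  match the inner bound.\<close>

lemma sector_step_bound_adjoint:
  fixes A D Q :: "'a::real_inner"
  assumes "sector l u (D - A) Q" "l < u" "0 < c" "0 < e" "norm D \<le> d * p"
  shows "(norm (A + c *\<^sub>R Q))\<^sup>2
    \<le> max ((1 - c * u)\<^sup>2 + c\<^sup>2 * d\<^sup>2 / e * u\<^sup>2) ((1 - c * l)\<^sup>2 + c\<^sup>2 * d\<^sup>2 / e * l\<^sup>2)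
      * ((norm A)\<^sup>2 + e * p\<^sup>2)" (is "_ \<le> ?M * ?N")
proof -
  define v where "v = A + c *\<^sub>R Q"
  obtain V where V: "sector l u v V" and VZ: "V \<bullet> (D - A) = v \<bullet> Q"
    using sector_adjoint[OF assms(1)] assms(2) by (metis less_imp_le)
  have e: "sqrt e \<noteq> 0" using assms(4) by simp
  have "(norm v)\<^sup>2 = A \<bullet> v + c * (v \<bullet> Q)"
    by (simp add: v_def power2_norm_eq_inner inner_add_left inner_add_right inner_commute algebra_simps)
  also have "\<dots> = A \<bullet> (v - c *\<^sub>R V) + c * (D \<bullet> V)"
    unfolding VZ[symmetric]
    by (simp add: inner_diff_left inner_diff_right inner_commute algebra_simps)
  also have "\<dots> \<le> norm A * norm (v - c *\<^sub>R V) + c * ((d * p) * norm V)"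
    using norm_cauchy_schwarz[of A "v - c *\<^sub>R V"] norm_cauchy_schwarz[of D V] assms(3,5)
      mult_right_mono[OF assms(5) norm_ge_zero[of V]]
    by (intro add_mono mult_left_mono) auto
  \<comment> \<open>Inserting \<open>sqrt e\<close> distributes the weight: \<open>e\<close> goes to
    \<open>p\<close>, and \<open>c\<^sup>2 * d\<^sup>2 / e\<close> to \<open>norm V\<close>.\<close>
  also have "c * ((d * p) * norm V) = (sqrt e * p) * (c * d / sqrt e * norm V)"
    using e by (simp add: field_simps)
  also have "norm A * norm (v - c *\<^sub>R V) + \<dots>
      \<le> sqrt ((norm A)\<^sup>2 + (sqrt e * p)\<^sup>2)
        * sqrt ((norm (v - c *\<^sub>R V))\<^sup>2 + (c * d / sqrt e * norm V)\<^sup>2)"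
    by (rule add_mult_le_sqrt_mult_sqrt)
  also have "\<dots> = sqrt (?N * ((norm (v - c *\<^sub>R V))\<^sup>2 + c\<^sup>2 * d\<^sup>2 / e * (norm V)\<^sup>2))"
    using assms(4) by (simp add: power_mult_distrib power_divide real_sqrt_mult)
  also have "\<dots> \<le> sqrt (?N * (?M * (norm v)\<^sup>2))"
    using assms(4)
    by (intro real_sqrt_le_mono mult_left_mono sector_quadratic_bound[OF V assms(2)]) auto
  also have "\<dots> = sqrt (?M * ?N) * norm v"
    by (simp add: real_sqrt_mult)
  finally have *: "norm v * norm v \<le> sqrt (?M * ?N) * norm v"
    by (simp add: power2_eq_square)
  have MN: "0 \<le> ?M * ?N"
    using assms(4) by (intro mult_nonneg_nonneg) (auto simp: le_max_iff_disj)
  have "norm v \<le> sqrt (?M * ?N)"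
    using * MN by (cases "v = 0") auto
  then have "(norm v)\<^sup>2 \<le> (sqrt (?M * ?N))\<^sup>2" by (intro power_mono) auto
  then show ?thesis using MN by (simp add: v_def)
qed

subsection \<open>Strongly convex functions\<close>

text \<open>Passes from extended to real values and treats \<open>\<mu> = 0\<close> and
  \<open>\<mu> > 0\<close> uniformly. Convexity excludes \<infinity> on the segment, properness
  excludes -\<infinity>.\<close>

lemma fun_class_convexE:
  fixes f :: "'a::real_inner \<Rightarrow> ereal"
  assumes f: "f \<in> fun_class \<mu> L" "0 \<le> \<mu>" and t: "0 < t" "t < 1"
    and x: "f x = ereal a" and y: "f y = ereal b"
  obtains c where "f ((1 - t) *\<^sub>R x + t *\<^sub>R y) = ereal c"
    "c \<le> (1 - t) * a + t * b - \<mu> / 2 * (t * (1 - t) * (norm (x - y))\<^sup>2)"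
proof -
  define z where "z = (1 - t) *\<^sub>R x + t *\<^sub>R y"
  have ccp: "ccp f" using f by (simp add: fun_class_def)
  then have "f z \<le> ereal (1 - t) * f x + ereal t * f y"
    using t by (auto simp: ccp_def ext_convex_def z_def)
  then have "f z \<noteq> \<infinity>" using x y by auto
  moreover have "f z \<noteq> -\<infinity>" using ccp by (simp add: ccp_def proper_fun_def)
  ultimately obtain c where c: "f z = ereal c" by (cases "f z") auto
  have "c \<le> (1 - t) * a + t * b - \<mu> / 2 * (t * (1 - t) * (norm (x - y))\<^sup>2)"
  proof (cases "\<mu> = 0")
    case True
    then show ?thesis using \<open>f z \<le> _\<close> c x y by simp
  next
    case False
    then have "strongly_convex \<mu> f" using f by (simp add: fun_class_def)
    then have "f z - ereal (\<mu> / 2 * (norm z)\<^sup>2)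
      \<le> ereal (1 - t) * (f x - ereal (\<mu> / 2 * (norm x)\<^sup>2)) + ereal t * (f y - ereal (\<mu> / 2 * (norm y)\<^sup>2))"
      unfolding strongly_convex_def ext_convex_def z_def using t by auto
    then have "c \<le> (1 - t) * a + t * b
        - \<mu> / 2 * ((1 - t) * (norm x)\<^sup>2 + t * (norm y)\<^sup>2 - (norm z)\<^sup>2)"
      using c x y by (simp add: algebra_simps add_divide_distrib diff_divide_distrib)
    then show ?thesis
      unfolding z_def norm_sq_convex_combination by simp
  qed
  then show thesis using that c by (simp add: z_def)
qed

text \<open>Makes the segment inequality applicable to functions known only to be CCP.\<close>

lemma ccp_iff_fun_class: "ccp f \<longleftrightarrow> f \<in> fun_class 0 \<infinity>"
  by (simp add: fun_class_def)

text \<open>\<open>Liminf (at x)\<close> ignores the point itself, and \<open>c < f x\<close>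
  supplies it; the bound then also covers sequences that hit their limit.\<close>

lemma lower_semicont_eventually:
  assumes "lower_semicont f" "c < f x"
  shows "\<forall>\<^sub>F y in nhds x. c < f y"
proof -
  have "c < Liminf (at x) f"
    using assms by (metis lower_semicont_def order_less_le_trans)
  then have "\<forall>\<^sub>F y in at x. c < f y" by (rule less_LiminfD)
  then show ?thesis
    using assms(2) by (auto simp: eventually_at_filter elim!: eventually_mono)
qed

text \<open>Lower semicontinuity bounds \<open>f\<close> below near a point of finiteness, and convexity
  propagates the bound along rays; this avoids the Hahn--Banach theorem.\<close>

lemma ccp_lower_bound:
  fixes f :: "'a::real_inner \<Rightarrow> ereal"
  assumes "ccp f"
  obtains x0 a K where "0 \<le> K" "\<And>y b. f y = ereal b \<Longrightarrow> a - K * norm (y - x0) \<le> b"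
proof -
  obtain x0 a where x0: "f x0 = ereal a"
    using assms by (auto simp: ccp_def proper_fun_def) (metis ereal_cases)
  have "\<forall>\<^sub>F y in nhds x0. ereal (a - 1) < f y"
    using assms by (intro lower_semicont_eventually) (auto simp: ccp_def x0)
  then obtain e where e: "0 < e" "\<And>y. dist y x0 < e \<Longrightarrow> ereal (a - 1) < f y"
    unfolding eventually_nhds_metric by blast
  \<comment> \<open>At distance \<open>e / 2\<close> the function has dropped by less than 1, and by
    convexity the average rate of descent over the whole segment is no greater.\<close>
  define K where "K = 2 / e"
  have "(a - 1) - K * norm (y - x0) \<le> b" if y: "f y = ereal b" for y b
  proof (cases "dist y x0 < e")
    case True
    then have "a - 1 < b" using e(2)[of y] y by simp
    moreover have "0 \<le> K * norm (y - x0)" using e(1) by (simp add: K_def)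
    ultimately show ?thesis by linarith
  next
    case False
    \<comment> \<open>\<open>t\<close> places the intermediate point at distance
      \<open>e / 2\<close> from \<open>x0\<close>, inside the ball where the local bound
      holds.\<close>
    define r t where "r = norm (y - x0)" and "t = e / (2 * r)"
    have r: "e \<le> r" using False by (simp add: r_def dist_norm)
    have t: "0 < t" "t < 1" using e(1) r by (auto simp: t_def field_simps)
    obtain c where c: "f ((1 - t) *\<^sub>R x0 + t *\<^sub>R y) = ereal c" "c \<le> (1 - t) * a + t * b"
      using fun_class_convexE[of f 0 \<infinity> t x0 a y b] assms t x0 y
      by (auto simp: ccp_iff_fun_class)
    have "(1 - t) *\<^sub>R x0 + t *\<^sub>R y - x0 = t *\<^sub>R (y - x0)" by (simp add: algebra_simps)
    then have "dist ((1 - t) *\<^sub>R x0 + t *\<^sub>R y) x0 = e / 2"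
      using e(1) r t by (simp add: dist_norm r_def[symmetric] t_def)
    then have "ereal (a - 1) < ereal c"
      unfolding c(1)[symmetric] using e(1) by (intro e(2)) simp
    then have "a - 1 < c" by simp
    then have "t * (a - b) < 1" using c(2) by (simp add: algebra_simps)
    then have "a - b < 1 / t" using t by (simp add: field_simps)
    also have "1 / t = K * r" using e(1) r by (simp add: t_def K_def)
    finally show ?thesis by (simp add: r_def)
  qed
  moreover have "0 \<le> K" using e(1) by (simp add: K_def)
  ultimately show thesis using that by blast
qed

subsection \<open>Proximal points and subgradients\<close>

text \<open>Direct method: a minimizing sequence is Cauchy by uniform convexity of the quadratic
  term, completeness gives a limit, and lower semicontinuity makes the limit a minimizer.\<close>

lemma prox_minimizer_exists:
  fixes f :: "'a::{real_inner, complete_space} \<Rightarrow> ereal"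
  assumes ccp: "ccp f" and \<alpha>: "0 < \<alpha>"
  obtains p b where "f p = ereal b"
    "\<And>y a. f y = ereal a \<Longrightarrow> \<alpha> * b + 1 / 2 * (norm (x - p))\<^sup>2 \<le> \<alpha> * a + 1 / 2 * (norm (x - y))\<^sup>2"
proof -
  \<comment> \<open>\<open>F\<close> is 0 where \<open>f\<close> is infinite, hence the restriction
    to \<open>S\<close> throughout.\<close>
  define F where "F y = real_of_ereal (f y)" for y
  define \<phi> where "\<phi> y = \<alpha> * F y + 1 / 2 * (norm (x - y))\<^sup>2" for y
  define S where "S = {y. f y \<noteq> \<infinity>}"
  have S: "f y = ereal (F y)" if "y \<in> S" for y
    using that ccp unfolding ccp_def proper_fun_def by (cases "f y") (simp_all add: S_def F_def)
  have "S \<noteq> {}" using ccp by (auto simp: S_def ccp_def proper_fun_def)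
  obtain x0 a K where K: "0 \<le> K" "\<And>y b. f y = ereal b \<Longrightarrow> a - K * norm (y - x0) \<le> b"
    using ccp_lower_bound[OF ccp] by metis
  have bdd: "bdd_below (\<phi> ` S)"
  proof (rule bdd_belowI2)
    fix y assume "y \<in> S"
    then have "\<alpha> * (a - K * norm (y - x0)) \<le> \<alpha> * F y"
      using K(2)[OF S] \<alpha> by (intro mult_left_mono) auto
    moreover have "(\<alpha> * K) * norm (y - x0) \<le> (\<alpha> * K) * (norm (x - x0) + norm (x - y))"
      using \<alpha> K(1) norm_triangle_ineq4[of "x - x0" "x - y"] by (intro mult_left_mono) auto
    \<comment> \<open>Completing the square: the quadratic term dominates the linear descent allowed
      by \<open>K\<close>.\<close>
    moreover have "0 \<le> (norm (x - y) - \<alpha> * K)\<^sup>2" by simp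
    ultimately show "\<alpha> * a - \<alpha> * K * norm (x - x0) - 1 / 2 * (\<alpha> * K)\<^sup>2 \<le> \<phi> y"
      by (simp add: \<phi>_def power2_diff) (simp add: algebra_simps)
  qed
  define m where "m = Inf (\<phi> ` S)"
  have m: "m \<le> \<phi> y" if "y \<in> S" for y
    unfolding m_def using that bdd by (intro cInf_lower) auto
  have "\<exists>y\<in>S. \<phi> y < m + 1 / real (Suc n)" for n
    using cInf_lessD[of "\<phi> ` S" "m + 1 / real (Suc n)"] \<open>S \<noteq> {}\<close> by (auto simp: m_def)
  then obtain s where s: "\<And>n. s n \<in> S" "\<And>n. \<phi> (s n) < m + 1 / real (Suc n)" by metis
  \<comment> \<open>The midpoint of \<open>y\<close> and \<open>z\<close> still costs at least
    \<open>m\<close>, while the quadratic term gains \<open>1 / 8 * (norm (y - z))\<^sup>2\<close>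
    there.\<close>
  have mid: "1 / 8 * (norm (y - z))\<^sup>2 \<le> (\<phi> y + \<phi> z) / 2 - m" if "y \<in> S" "z \<in> S" for y z
  proof -
    define w where "w = (1 - 1 / 2) *\<^sub>R y + (1 / 2) *\<^sub>R z"
    have fin: "f y = ereal (F y)" "f z = ereal (F z)" using S that by auto
    obtain c where c: "f w = ereal c" "c \<le> (1 - 1 / 2) * F y + 1 / 2 * F z"
      using fun_class_convexE[of f 0 \<infinity> "1 / 2" y "F y" z "F z"] ccp fin
      by (auto simp: ccp_iff_fun_class w_def)
    then have "w \<in> S" "F w \<le> (F y + F z) / 2" by (auto simp: S_def F_def field_simps)
    have "\<alpha> * F w \<le> \<alpha> * ((F y + F z) / 2)" using \<open>F w \<le> _\<close> \<alpha> by simp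
    moreover have "x - w = (1 - 1 / 2) *\<^sub>R (x - y) + (1 / 2) *\<^sub>R (x - z)"
      by (simp add: w_def algebra_simps flip: scaleR_add_left)
    then have "(norm (x - w))\<^sup>2
        = 1 / 2 * (norm (x - y))\<^sup>2 + 1 / 2 * (norm (x - z))\<^sup>2 - 1 / 4 * (norm (y - z))\<^sup>2"
      by (simp only: norm_sq_convex_combination) (simp add: norm_minus_commute)
    ultimately show ?thesis
      using m[OF \<open>w \<in> S\<close>] by (simp add: \<phi>_def field_simps)
  qed
  have "Cauchy s"
  proof (rule metric_CauchyI)
    fix e :: real assume "0 < e"
    obtain N :: nat where "1 / real (Suc N) < e\<^sup>2 / 8"
      using reals_Archimedean[of "e\<^sup>2 / 8"] \<open>0 < e\<close> by (auto simp: inverse_eq_divide)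
    then have N: "8 * (1 / real (Suc N)) < e\<^sup>2" by simp
    have "dist (s i) (s j) < e" if "N \<le> i" "N \<le> j" for i j
    proof -
      have "1 / real (Suc i) \<le> 1 / real (Suc N)" "1 / real (Suc j) \<le> 1 / real (Suc N)"
        using that by (auto intro!: divide_left_mono)
      then have "(norm (s i - s j))\<^sup>2 < e\<^sup>2"
        using mid[OF s(1) s(1), of i j] s(2)[of i] s(2)[of j] N by argo
      then show ?thesis
        using \<open>0 < e\<close> by (auto simp: dist_norm intro: power2_less_imp_less)
    qed
    then show "\<exists>N. \<forall>i\<ge>N. \<forall>j\<ge>N. dist (s i) (s j) < e" by blast
  qed
  then obtain p where p: "s \<longlonglongrightarrow> p" using Cauchy_convergent convergent_def by blast
  \<comment> \<open>The value of \<open>f p\<close> for which the objective at \<open>p\<close>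
    equals \<open>m\<close>. Since \<open>f p\<close> is not yet known to be finite, it is
    approached through real numbers \<open>c\<close> below it.\<close>
  define B where "B = (m - 1 / 2 * (norm (x - p))\<^sup>2) / \<alpha>"
  have "c \<le> B" if c: "ereal c < f p" for c
  proof -
    have "\<forall>\<^sub>F y in nhds p. ereal c < f y"
      using ccp c by (intro lower_semicont_eventually) (auto simp: ccp_def)
    then have "\<forall>\<^sub>F n in sequentially. ereal c < f (s n)"
      using p by (auto simp: filterlim_iff)
    then have "\<forall>\<^sub>F n in sequentially.
        \<alpha> * c + 1 / 2 * (norm (x - s n))\<^sup>2 \<le> m + 1 / real (Suc n)"
    proof eventually_elim
      case (elim n)
      then have "c < F (s n)" using S[OF s(1)] by simp
      then have "\<alpha> * c \<le> \<alpha> * F (s n)" using \<alpha> by simp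
      then show ?case using s(2)[of n] by (simp add: \<phi>_def)
    qed
    moreover have "(\<lambda>n. \<alpha> * c + 1 / 2 * (norm (x - s n))\<^sup>2)
        \<longlonglongrightarrow> \<alpha> * c + 1 / 2 * (norm (x - p))\<^sup>2"
      by (intro tendsto_intros p)
    moreover have "(\<lambda>n. m + 1 / real (Suc n)) \<longlonglongrightarrow> m + 0"
      by (intro tendsto_add tendsto_const LIMSEQ_Suc[OF lim_1_over_n])
    ultimately have "\<alpha> * c + 1 / 2 * (norm (x - p))\<^sup>2 \<le> m"
      using tendsto_le[OF sequentially_bot] by fastforce
    then show ?thesis using \<alpha> by (simp add: B_def field_simps)
  qed
  then have "\<not> ereal B < f p"
    by (meson ereal_dense2 ereal_less_eq(3) less_ereal.simps(1) not_le)
  then have "f p \<le> ereal B" by simp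
  then have "p \<in> S" by (auto simp: S_def)
  with \<open>f p \<le> ereal B\<close> have "F p \<le> B" by (simp add: S)
  show thesis
  proof
    show "f p = ereal (F p)" using \<open>p \<in> S\<close> by (rule S)
    show "\<alpha> * F p + 1 / 2 * (norm (x - p))\<^sup>2 \<le> \<alpha> * a + 1 / 2 * (norm (x - y))\<^sup>2"
      if "f y = ereal a" for y a
    proof -
      have "y \<in> S" "F y = a" using that by (auto simp: S_def F_def)
      then show ?thesis
        using m[of y] \<open>F p \<le> B\<close> \<alpha> by (simp add: \<phi>_def B_def field_simps)
    qed
  qed
qed

text \<open>Once a minimizer \<open>q\<close> exists, the choice made by \<open>arg_min\<close> is
  one too; comparison with \<open>q\<close> makes its value finite.\<close>

lemma prox_minimal:
  fixes f :: "'a::{real_inner, complete_space} \<Rightarrow> ereal"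
  assumes ccp: "ccp f" and \<alpha>: "0 < \<alpha>"
  obtains b where "f (prox \<alpha> f x) = ereal b"
    "\<And>y a. f y = ereal a \<Longrightarrow>
      \<alpha> * b + 1 / 2 * (norm (x - prox \<alpha> f x))\<^sup>2 \<le> \<alpha> * a + 1 / 2 * (norm (x - y))\<^sup>2"
proof -
  define \<Phi> where "\<Phi> y = ereal \<alpha> * f y + ereal (1 / 2 * (norm (x - y))\<^sup>2)" for y
  obtain q c where q: "f q = ereal c"
    "\<And>y a. f y = ereal a \<Longrightarrow> \<alpha> * c + 1 / 2 * (norm (x - q))\<^sup>2 \<le> \<alpha> * a + 1 / 2 * (norm (x - y))\<^sup>2"
    using prox_minimizer_exists[OF ccp \<alpha>] by blast
  have fin: "f y \<noteq> -\<infinity>" for y using ccp by (simp add: ccp_def proper_fun_def)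
  have q_min: "\<Phi> q \<le> \<Phi> y" for y
    using q fin[of y] \<alpha> by (cases "f y") (auto simp: \<Phi>_def)
  have min: "\<Phi> (prox \<alpha> f x) \<le> \<Phi> y" for y
    unfolding prox_def \<Phi>_def[symmetric]
    by (rule arg_minI[of "\<lambda>_. True" q \<Phi> "\<lambda>p. \<Phi> p \<le> \<Phi> y"]) (use q_min in \<open>auto simp: not_less\<close>)
  obtain b where b: "f (prox \<alpha> f x) = ereal b"
    using min[of q] q(1) fin[of "prox \<alpha> f x"] \<alpha>
    by (cases "f (prox \<alpha> f x)") (auto simp: \<Phi>_def)
  show thesis
  proof
    show "f (prox \<alpha> f x) = ereal b" by (rule b)
    show "\<alpha> * b + 1 / 2 * (norm (x - prox \<alpha> f x))\<^sup>2 \<le> \<alpha> * a + 1 / 2 * (norm (x - y))\<^sup>2"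
      if "f y = ereal a" for y a
      using min[of y] that b by (simp add: \<Phi>_def)
  qed
qed

text \<open>For \<open>\<mu> = 0\<close> and proper \<open>f\<close> this is membership in the
  convex subdifferential. Points of value \<infinity> impose no condition, so the inequality can
  live in the reals.\<close>

definition strong_subgradient :: "real \<Rightarrow> ('a::real_inner \<Rightarrow> ereal) \<Rightarrow> 'a \<Rightarrow> 'a \<Rightarrow> bool" where
  "strong_subgradient \<mu> f p s \<longleftrightarrow>
    (\<exists>b. f p = ereal b \<and>
      (\<forall>y a. f y = ereal a \<longrightarrow> b + s \<bullet> (y - p) + \<mu> / 2 * (norm (y - p))\<^sup>2 \<le> a))"

text \<open>Testing each inequality at the other point and adding cancels the function
  values.\<close>

lemma strong_subgradient_monotone:
  assumes "strong_subgradient \<mu> f p s" "strong_subgradient \<mu> f q r"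
  shows "\<mu> * (norm (p - q))\<^sup>2 \<le> (s - r) \<bullet> (p - q)"
proof -
  obtain b c where "b + s \<bullet> (q - p) + \<mu> / 2 * (norm (q - p))\<^sup>2 \<le> c"
    "c + r \<bullet> (p - q) + \<mu> / 2 * (norm (p - q))\<^sup>2 \<le> b"
    using assms unfolding strong_subgradient_def by blast
  then show ?thesis
    by (simp add: norm_minus_commute inner_diff_left inner_diff_right)
qed

text \<open>Compare the minimizer with points on the segment towards \<open>y\<close>, divide by
  \<open>t\<close> and let \<open>t\<close> tend to 0.\<close>

lemma prox_strong_subgradient:
  fixes f :: "'a::{real_inner, complete_space} \<Rightarrow> ereal"
  assumes f: "f \<in> fun_class \<mu> L" "0 \<le> \<mu>" and \<alpha>: "0 < \<alpha>"
  shows "strong_subgradient \<mu> f (prox \<alpha> f x) ((1 / \<alpha>) *\<^sub>R (x - prox \<alpha> f x))"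
proof -
  define p where "p = prox \<alpha> f x"
  have "ccp f" using f by (simp add: fun_class_def)
  then obtain b where b: "f p = ereal b"
    "\<And>y a. f y = ereal a \<Longrightarrow> \<alpha> * b + 1 / 2 * (norm (x - p))\<^sup>2 \<le> \<alpha> * a + 1 / 2 * (norm (x - y))\<^sup>2"
    using prox_minimal[OF _ \<alpha>, of f x] unfolding p_def by blast
  have "b + ((1 / \<alpha>) *\<^sub>R (x - p)) \<bullet> (y - p) + \<mu> / 2 * (norm (y - p))\<^sup>2 \<le> a"
    if y: "f y = ereal a" for y a
  proof -
    define N where "N = (norm (y - p))\<^sup>2"
    \<comment> \<open>\<open>\<alpha>\<close> times the violation of the claimed inequality, to be
      shown nonpositive.\<close>
    define J where "J = \<alpha> * b + (x - p) \<bullet> (y - p) + \<alpha> * \<mu> / 2 * N - \<alpha> * a"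
    have *: "J \<le> t * ((1 + \<alpha> * \<mu>) / 2 * N)" if t: "0 < t" "t < 1" for t
    proof -
      define z where "z = (1 - t) *\<^sub>R p + t *\<^sub>R y"
      obtain c where c: "f z = ereal c" "c \<le> (1 - t) * b + t * a - \<mu> / 2 * (t * (1 - t) * N)"
        using fun_class_convexE[OF f t b(1) y] by (auto simp: z_def N_def norm_minus_commute)
      have "x - z = (x - p) - t *\<^sub>R (y - p)" by (simp add: z_def algebra_simps)
      then have "(norm (x - z))\<^sup>2 = (norm (x - p))\<^sup>2 - 2 * t * ((x - p) \<bullet> (y - p)) + t\<^sup>2 * N"
        by (simp only: N_def power2_norm_eq_inner inner_diff_left[of "x - p"]
            inner_diff_right[of _ "x - p"])
          (simp add: inner_commute power2_eq_square)
      moreover have "\<alpha> * c \<le> \<alpha> * ((1 - t) * b + t * a - \<mu> / 2 * (t * (1 - t) * N))"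
        using c(2) \<alpha> by simp
      ultimately have "t * J \<le> t * (t * ((1 + \<alpha> * \<mu>) / 2 * N))"
        using b(2)[OF c(1)] by (simp add: J_def power2_eq_square field_simps)
      then show ?thesis using t by simp
    qed
    have "((\<lambda>t. t * ((1 + \<alpha> * \<mu>) / 2 * N)) \<longlongrightarrow> 0 * ((1 + \<alpha> * \<mu>) / 2 * N)) (at_right 0)"
      by (intro tendsto_intros)
    moreover have "\<forall>\<^sub>F t in at_right 0. J \<le> t * ((1 + \<alpha> * \<mu>) / 2 * N)"
      using * by (auto simp: eventually_at_right_field intro!: exI[of _ 1])
    ultimately have "J \<le> 0"
      using tendsto_lowerbound[of _ 0 "at_right (0::real)" J] by simp
    then have "J / \<alpha> \<le> 0" using \<alpha> by (simp add: divide_nonpos_pos)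
    then show ?thesis
      unfolding inner_scaleR_left J_def N_def using \<alpha> by (simp add: field_simps)
  qed
  then show ?thesis unfolding strong_subgradient_def p_def[symmetric] using b(1) by blast
qed

subsection \<open>Smooth functions\<close>

lemma GDERIV_along_line:
  assumes "GDERIV F (p + t *\<^sub>R v) :> D"
  shows "((\<lambda>t. F (p + t *\<^sub>R v)) has_real_derivative v \<bullet> D) (at t)"
proof -
  have "((\<lambda>t. p + t *\<^sub>R v) has_derivative (\<lambda>h. h *\<^sub>R v)) (at t)"
    by (auto intro!: derivative_eq_intros)
  from has_derivative_compose[OF this assms[unfolded gderiv_def]]
  have "((\<lambda>t. F (p + t *\<^sub>R v)) has_derivative (\<lambda>h. (h *\<^sub>R v) \<bullet> D)) (at t)" .
  moreover have "(\<lambda>h. (h *\<^sub>R v) \<bullet> D) = (*) (v \<bullet> D)" by (simp add: fun_eq_iff)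
  ultimately show ?thesis by (simp add: has_field_derivative_def)
qed

lemma GDERIV_unique:
  assumes "GDERIV F x :> D" "GDERIV F x :> E"
  shows "D = E"
proof -
  have "h \<bullet> D = h \<bullet> E" for h
    using has_derivative_unique assms unfolding gderiv_def by metis
  then show ?thesis by (metis vector_eq_ldot)
qed

text \<open>Subtracting the linear and quadratic terms along the segment leaves a function whose
  derivative is nonpositive by the Lipschitz bound.\<close>

lemma descent_lemma:
  fixes F :: "'a::real_inner \<Rightarrow> real"
  assumes G: "\<And>x. GDERIV F x :> G x" and L: "L-lipschitz_on UNIV G"
  shows "F (x + v) \<le> F x + G x \<bullet> v + L / 2 * (norm v)\<^sup>2"
proof -
  define \<psi> where "\<psi> t = F (x + t *\<^sub>R v) - t * (G x \<bullet> v) - t\<^sup>2 * (L / 2 * (norm v)\<^sup>2)" for t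
  have "\<psi> 1 \<le> \<psi> 0"
  proof (rule DERIV_nonpos_imp_nonincreasing[of 0 1 \<psi>])
    fix t :: real assume "0 \<le> t" "t \<le> 1"
    have "(\<psi> has_real_derivative
        v \<bullet> G (x + t *\<^sub>R v) - G x \<bullet> v - 2 * t * (L / 2 * (norm v)\<^sup>2)) (at t)"
      unfolding \<psi>_def by (auto intro!: derivative_eq_intros GDERIV_along_line G)
    moreover have "v \<bullet> G (x + t *\<^sub>R v) - G x \<bullet> v - 2 * t * (L / 2 * (norm v)\<^sup>2) \<le> 0"
    proof -
      have "(G (x + t *\<^sub>R v) - G x) \<bullet> v \<le> norm (G (x + t *\<^sub>R v) - G x) * norm v"
        by (rule norm_cauchy_schwarz)
      also have "\<dots> \<le> (L * norm (t *\<^sub>R v)) * norm v"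
        using lipschitz_onD[OF L, of "x + t *\<^sub>R v" x]
        by (intro mult_right_mono) (auto simp: dist_norm)
      finally show ?thesis
        using \<open>0 \<le> t\<close> by (simp add: inner_diff_left inner_diff_right inner_commute power2_eq_square mult_ac)
    qed
    ultimately show "\<exists>y. (\<psi> has_real_derivative y) (at t) \<and> y \<le> 0" by blast
  qed simp
  then show ?thesis by (simp add: \<psi>_def)
qed

text \<open>Uniqueness of gradients identifies the definite description \<open>gradient f\<close>
  with the Lipschitz map supplied by smoothness.\<close>

lemma fun_class_gradientE:
  fixes f :: "'a::real_inner \<Rightarrow> ereal"
  assumes "f \<in> fun_class \<mu> (ereal L)"
  shows "\<And>x. f x = ereal (real_of_ereal (f x))"
    and "\<And>x. GDERIV (\<lambda>y. real_of_ereal (f y)) x :> gradient f x"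
    and "L-lipschitz_on UNIV (gradient f)"
proof -
  have "smooth_fun L f" using assms by (simp add: fun_class_def)
  then obtain G where fin: "\<And>x. \<bar>f x\<bar> \<noteq> \<infinity>"
    and G: "\<And>x. GDERIV (\<lambda>y. real_of_ereal (f y)) x :> G x" and L: "L-lipschitz_on UNIV G"
    unfolding smooth_fun_def by blast
  have "gradient f x = G x" for x
    unfolding gradient_def using G GDERIV_unique by (intro the_equality) blast+
  then have "gradient f = G" by blast
  then show "\<And>x. f x = ereal (real_of_ereal (f x))"
    "\<And>x. GDERIV (\<lambda>y. real_of_ereal (f y)) x :> gradient f x"
    "L-lipschitz_on UNIV (gradient f)"
    using fin G L by (simp_all add: ereal_real)
qed

text \<open>The slack \<open>\<psi>\<close> of strong convexity along the segment is nonnegative and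
  vanishes at 0, so its derivative there, which is the slack of the claim, cannot be
  negative.\<close>

lemma gradient_strong_subgradient:
  assumes f: "f \<in> fun_class \<mu> (ereal L)" "0 \<le> \<mu>"
  shows "strong_subgradient \<mu> f p (gradient f p)"
proof -
  define F where "F y = real_of_ereal (f y)" for y
  note fin = fun_class_gradientE(1)[OF f(1), folded F_def]
  note G = fun_class_gradientE(2)[OF f(1), folded F_def]
  have "F p + gradient f p \<bullet> (y - p) + \<mu> / 2 * (norm (y - p))\<^sup>2 \<le> F y" for y
  proof (rule ccontr)
    assume neg: "\<not> ?thesis"
    define N where "N = (norm (y - p))\<^sup>2"
    define \<psi> where "\<psi> t = (1 - t) * F p + t * F y - \<mu> / 2 * (t * (1 - t) * N)
        - F (p + t *\<^sub>R (y - p))" for t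
    have "(\<psi> has_real_derivative F y - F p - \<mu> / 2 * N - (y - p) \<bullet> gradient f p) (at 0)"
      unfolding \<psi>_def by (auto intro!: derivative_eq_intros GDERIV_along_line G)
    moreover have "F y - F p - \<mu> / 2 * N - (y - p) \<bullet> gradient f p < 0"
      using neg by (simp add: N_def inner_commute)
    ultimately obtain d where d: "0 < d" "\<And>t. 0 < t \<Longrightarrow> t < d \<Longrightarrow> \<psi> t < \<psi> 0"
      using DERIV_neg_dec_right by (metis add_0)
    define t where "t = min (d / 2) (1 / 2)"
    have t: "0 < t" "t < 1" "t < d" using d(1) by (auto simp: t_def)
    have "(1 - t) *\<^sub>R p + t *\<^sub>R y = p + t *\<^sub>R (y - p)" by (simp add: algebra_simps)
    moreover obtain c where "f ((1 - t) *\<^sub>R p + t *\<^sub>R y) = ereal c"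
      "c \<le> (1 - t) * F p + t * F y - \<mu> / 2 * (t * (1 - t) * N)"
      using fun_class_convexE[OF f t(1,2) fin fin] by (auto simp: N_def norm_minus_commute)
    ultimately have "0 \<le> \<psi> t" by (simp add: \<psi>_def F_def)
    moreover have "\<psi> 0 = 0" by (simp add: \<psi>_def)
    ultimately show False using d(2)[OF t(1,3)] by simp
  qed
  then show ?thesis
    unfolding strong_subgradient_def using fin by (metis ereal.inject)
qed

text \<open>The point \<open>p\<close> minimizes \<open>F\<close> minus the linear form given by
  \<open>s\<close>, so the derivative vanishes there.\<close>

lemma strong_subgradient_eq_gradient:
  assumes f: "f \<in> fun_class \<mu> (ereal L)" "0 \<le> \<mu>" and s: "strong_subgradient \<mu> f p s"
  shows "s = gradient f p"
proof -
  define F where "F y = real_of_ereal (f y)" for y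
  note fin = fun_class_gradientE(1)[OF f(1), folded F_def]
  note G = fun_class_gradientE(2)[OF f(1), folded F_def]
  have *: "F p + s \<bullet> (y - p) + \<mu> / 2 * (norm (y - p))\<^sup>2 \<le> F y" for y
    using s fin unfolding strong_subgradient_def by (metis ereal.inject)
  have "F p - p \<bullet> s \<le> F y - y \<bullet> s" for y
  proof -
    have "0 \<le> \<mu> / 2 * (norm (y - p))\<^sup>2" using f(2) by simp
    then show ?thesis
      using *[of y] unfolding inner_diff_right inner_commute[of _ s] by linarith
  qed
  moreover have "((\<lambda>y. F y - y \<bullet> s) has_derivative (\<lambda>h. h \<bullet> gradient f p - h \<bullet> s)) (at p)"
    using G[of p] unfolding gderiv_def by (auto intro!: derivative_eq_intros)
  ultimately have "(\<lambda>h. h \<bullet> gradient f p - h \<bullet> s) = (\<lambda>h. 0)"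
    by (intro has_derivative_local_min[where f = "\<lambda>y. F y - y \<bullet> s"]) auto
  then have "h \<bullet> gradient f p = h \<bullet> s" for h by (metis eq_iff_diff_eq_0)
  then show ?thesis by (metis vector_eq_ldot)
qed

text \<open>Cocoercivity of the gradient of \<open>f\<close> minus its
  \<open>\<mu>\<close>-quadratic: the lower bound at \<open>p\<close> and the descent bound at
  \<open>q\<close> meet at an auxiliary point. Exchanging \<open>p\<close> and \<open>q\<close> and
  adding removes the values of \<open>F\<close>.\<close>

lemma gradient_sector:
  assumes f: "f \<in> fun_class \<mu> (ereal L)" "0 \<le> \<mu>" "\<mu> < L"
  shows "sector \<mu> L (p - q) (gradient f p - gradient f q)"
proof -
  define F where "F y = real_of_ereal (f y)" for y
  note fin = fun_class_gradientE(1)[OF f(1), folded F_def]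
  note descent = descent_lemma[OF fun_class_gradientE(2,3)[OF f(1)], folded F_def]
  let ?G = "gradient f"
  define K where "K = L - \<mu>"
  have K: "0 < K" using f(3) by (simp add: K_def)
  have lower: "F p + ?G p \<bullet> (z - p) + \<mu> / 2 * (norm (z - p))\<^sup>2 \<le> F z" for p z
    using gradient_strong_subgradient[OF f(1,2), of p] fin
    unfolding strong_subgradient_def by (metis ereal.inject)
  have *: "F p + ?G p \<bullet> (q - p) + \<mu> / 2 * (norm (q - p))\<^sup>2
      + 1 / (2 * K) * (norm (?G q - ?G p - \<mu> *\<^sub>R (q - p)))\<^sup>2 \<le> F q" for p q
  proof -
    \<comment> \<open>\<open>w\<close> maximizes
      \<open>E \<bullet> w - K / 2 * (norm w)\<^sup>2\<close>, the gain from comparing at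
      \<open>q - w\<close>.\<close>
    define v E w where "v = q - p" and "E = ?G q - ?G p - \<mu> *\<^sub>R v" and "w = (1 / K) *\<^sub>R E"
    have "F p + ?G p \<bullet> (v - w) + \<mu> / 2 * (norm (v - w))\<^sup>2 \<le> F (q + (- w))"
      using lower[of p "q + (- w)"] by (simp add: v_def algebra_simps)
    also have "\<dots> \<le> F q - ?G q \<bullet> w + L / 2 * (norm w)\<^sup>2"
      using descent[of q "- w"] by simp
    finally have "F p + ?G p \<bullet> v + \<mu> / 2 * (norm v)\<^sup>2 + E \<bullet> w - K / 2 * (norm w)\<^sup>2 \<le> F q"
      by (simp add: E_def K_def power2_norm_eq_inner inner_diff_left inner_diff_right
          inner_commute algebra_simps diff_divide_distrib)
    moreover have "E \<bullet> w - K / 2 * (norm w)\<^sup>2 = 1 / (2 * K) * (norm E)\<^sup>2"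
      using K by (simp add: w_def power_mult_distrib power_divide power2_norm_eq_inner)
        (simp add: field_simps power2_eq_square)
    ultimately show ?thesis by (simp add: v_def E_def)
  qed
  define v E where "v = p - q" and "E = ?G p - ?G q - \<mu> *\<^sub>R v"
  have "norm (?G q - ?G p - \<mu> *\<^sub>R (q - p)) = norm E"
    unfolding E_def v_def by (subst norm_minus_cancel[symmetric]) (simp add: algebra_simps)
  then have "F p - ?G p \<bullet> v + \<mu> / 2 * (norm v)\<^sup>2 + 1 / (2 * K) * (norm E)\<^sup>2 \<le> F q"
    using *[of p q] by (simp add: v_def norm_minus_commute inner_diff_right)
  moreover have "F q + ?G q \<bullet> v + \<mu> / 2 * (norm v)\<^sup>2 + 1 / (2 * K) * (norm E)\<^sup>2 \<le> F p"
    using *[of q p] by (simp add: v_def E_def)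
  moreover have "E \<bullet> v = ?G p \<bullet> v - ?G q \<bullet> v - \<mu> * (norm v)\<^sup>2"
    by (simp add: E_def inner_diff_left power2_norm_eq_inner)
  ultimately have "1 / K * (norm E)\<^sup>2 \<le> E \<bullet> v" by simp
  then have "(norm E)\<^sup>2 \<le> K * (E \<bullet> v)" using K by (simp add: field_simps)
  then have "0 \<le> E \<bullet> (K *\<^sub>R v - E)"
    by (simp add: inner_diff_right power2_norm_eq_inner)
  also have "K *\<^sub>R v - E = L *\<^sub>R v - (?G p - ?G q)"
    by (simp add: K_def E_def algebra_simps)
  finally show ?thesis by (simp add: sector_def E_def v_def)
qed

subsection \<open>Lipschitz bounds\<close>

lemma res_coeff_bounds:
  assumes "0 \<le> \<mu>" "ereal \<mu> < L" "0 < \<alpha>"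
  shows "0 \<le> res_coeff \<alpha> L" "res_coeff \<alpha> L < 1 / (1 + \<alpha> * \<mu>)"
proof -
  have "0 < 1 + \<alpha> * \<mu>" using assms by (simp add: add_pos_nonneg)
  then show "0 \<le> res_coeff \<alpha> L" "res_coeff \<alpha> L < 1 / (1 + \<alpha> * \<mu>)"
    using assms by (cases L; simp add: res_coeff_def one_ereal_def frac_less2 add_pos_nonneg)+
qed

text \<open>With \<open>S = s x - s y\<close> one has \<open>X - P = \<alpha> *\<^sub>R S\<close>,
  so both factors of the sector for \<open>X\<close>, \<open>P\<close> are nonnegative multiples of
  factors for \<open>P\<close>, \<open>S\<close>. Finite \<open>L\<close> then reduces to the
  gradient sector; \<open>L = \<infinity>\<close> gives \<open>l = 0\<close> and reduces to strong
  monotonicity.\<close>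

lemma prox_sector:
  fixes f :: "'a::{real_inner, complete_space} \<Rightarrow> ereal"
  assumes f: "f \<in> fun_class \<mu> L" and \<mu>: "0 \<le> \<mu>" "ereal \<mu> < L" and \<alpha>: "0 < \<alpha>"
  shows "sector (res_coeff \<alpha> L) (1 / (1 + \<alpha> * \<mu>)) (x - y) (prox \<alpha> f x - prox \<alpha> f y)"
proof -
  define X P where "X = x - y" and "P = prox \<alpha> f x - prox \<alpha> f y"
  define s where "s z = (1 / \<alpha>) *\<^sub>R (z - prox \<alpha> f z)" for z
  have s: "strong_subgradient \<mu> f (prox \<alpha> f z) (s z)" for z
    unfolding s_def by (rule prox_strong_subgradient[OF f \<mu>(1) \<alpha>])
  have "s x - s y = (1 / \<alpha>) *\<^sub>R (X - P)"
    by (simp add: s_def X_def P_def algebra_simps)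
  then have X: "X - P = \<alpha> *\<^sub>R (s x - s y)" using \<alpha> by simp
  define u where "u = 1 / (1 + \<alpha> * \<mu>)"
  have u: "0 < u" "u * (1 + \<alpha> * \<mu>) = 1"
  proof -
    have "0 < 1 + \<alpha> * \<mu>" using \<alpha> \<mu> by (simp add: add_pos_nonneg)
    then show "0 < u" "u * (1 + \<alpha> * \<mu>) = 1" by (simp_all add: u_def)
  qed
  have uX: "u *\<^sub>R X - P = u *\<^sub>R (\<alpha> *\<^sub>R ((s x - s y) - \<mu> *\<^sub>R P))"
  proof -
    have "u *\<^sub>R X - P = u *\<^sub>R X - (u * (1 + \<alpha> * \<mu>)) *\<^sub>R P" using u by simp
    also have "\<dots> = u *\<^sub>R ((X - P) - (\<alpha> * \<mu>) *\<^sub>R P)" by (simp add: algebra_simps)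
    finally show ?thesis by (simp add: X algebra_simps)
  qed
  show ?thesis
  proof (cases L)
    case (real M)
    then have M: "0 < 1 + \<alpha> * M" using \<mu> \<alpha> by (simp add: add_pos_nonneg)
    define l where "l = 1 / (1 + \<alpha> * M)"
    have l: "0 < l" "l * (1 + \<alpha> * M) = 1" using M by (simp_all add: l_def)
    have "P - l *\<^sub>R X = (l * (1 + \<alpha> * M)) *\<^sub>R P - l *\<^sub>R X" using l by simp
    also have "\<dots> = l *\<^sub>R ((\<alpha> * M) *\<^sub>R P - (X - P))" by (simp add: algebra_simps)
    finally have lX: "P - l *\<^sub>R X = l *\<^sub>R (\<alpha> *\<^sub>R (M *\<^sub>R P - (s x - s y)))"
      by (simp add: X algebra_simps)
    have "s z = gradient f (prox \<alpha> f z)" for z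
      using strong_subgradient_eq_gradient[of f \<mu> M] f real \<mu>(1) s by simp
    then have "sector \<mu> M P (s x - s y)"
      using gradient_sector[of f \<mu> M] f real \<mu> by (simp add: P_def)
    then have "0 \<le> (P - l *\<^sub>R X) \<bullet> (u *\<^sub>R X - P)"
      unfolding lX uX sector_def using l(1) u(1) \<alpha> by (simp add: inner_commute)
    then show ?thesis
      using real M by (simp add: sector_def res_coeff_def one_ereal_def l_def u_def X_def P_def)
  next
    case PInf
    have "0 \<le> ((s x - s y) - \<mu> *\<^sub>R P) \<bullet> P"
      using strong_subgradient_monotone[OF s s, of x y]
      by (simp add: P_def inner_diff_left[of _ "\<mu> *\<^sub>R _"] power2_norm_eq_inner)
    then have "0 \<le> P \<bullet> (u *\<^sub>R X - P)"
      unfolding uX using u(1) \<alpha> by (simp add: inner_commute)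
    then show ?thesis
      using PInf \<alpha> by (simp add: sector_def res_coeff_def u_def X_def P_def)
  next
    case MInf
    then show ?thesis using \<mu> by simp
  qed
qed

text \<open>The affine image of the ball is a ball centred on the line through \<open>x\<close>, so
  its point farthest from 0 can be taken at an end of the diameter along that line.\<close>

lemma sector_norm_affine_le:
  fixes x y :: "'a::real_inner"
  assumes "sector l u x y" "l \<le> u" "0 \<le> \<alpha>"
  shows "norm (c *\<^sub>R x - \<alpha> *\<^sub>R y) \<le> max \<bar>c - \<alpha> * l\<bar> \<bar>c - \<alpha> * u\<bar> * norm x"
proof -
  define W where "W = y - (1 / 2 * (u + l)) *\<^sub>R x"
  have "(norm W)\<^sup>2 \<le> (1 / 2 * (u - l) * norm x)\<^sup>2"
    using assms(1) by (simp add: sector_iff_ball W_def power_mult_distrib power_divide)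
  then have W: "norm W \<le> 1 / 2 * (u - l) * norm x"
    by (rule power2_le_imp_le) (simp add: assms(2))
  have "c *\<^sub>R x - \<alpha> *\<^sub>R y = (c - \<alpha> * (1 / 2 * (u + l))) *\<^sub>R x - \<alpha> *\<^sub>R W"
    by (simp add: W_def algebra_simps)
  then have "norm (c *\<^sub>R x - \<alpha> *\<^sub>R y)
      \<le> \<bar>c - \<alpha> * (1 / 2 * (u + l))\<bar> * norm x + \<alpha> * norm W"
    using norm_triangle_ineq4[of "(c - \<alpha> * (1 / 2 * (u + l))) *\<^sub>R x" "\<alpha> *\<^sub>R W"] assms(3) by simp
  also have "\<dots> \<le> \<bar>c - \<alpha> * (1 / 2 * (u + l))\<bar> * norm x + \<alpha> * (1 / 2 * (u - l) * norm x)"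
    using W assms(3) by (intro add_left_mono mult_left_mono)
  also have "\<dots> = (\<bar>c - \<alpha> * (1 / 2 * (u + l))\<bar> + \<alpha> * (1 / 2 * (u - l))) * norm x"
    by (simp add: algebra_simps)
  \<comment> \<open>For a nonnegative radius \<open>r\<close>, the sum of \<bar>m\<bar> and
    \<open>r\<close> is the larger of \<bar>m - r\<bar> and \<bar>m + r\<bar>.\<close>
  also have "\<dots> \<le> max \<bar>c - \<alpha> * l\<bar> \<bar>c - \<alpha> * u\<bar> * norm x"
    using mult_left_mono[OF assms(2,3)]
    by (intro mult_right_mono) (auto simp: field_simps abs_if max_def)
  finally show ?thesis .
qed

section \<open>From sector estimates to the splitting operator\<close>

lemma lipschitz_on_sqrtI:
  fixes T :: "'a::real_normed_vector \<Rightarrow> 'b::real_normed_vector"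
  assumes "0 \<le> K" "\<And>x y. (norm (T x - T y))\<^sup>2 \<le> K * (norm (x - y))\<^sup>2"
  shows "\<exists>\<rho>\<ge>0. \<rho>\<^sup>2 = K \<and> \<rho>-lipschitz_on UNIV T"
proof (intro exI conjI)
  show "0 \<le> sqrt K" "(sqrt K)\<^sup>2 = K" using assms(1) by simp_all
  have "norm (T x - T y) \<le> sqrt K * norm (x - y)" for x y
    using real_sqrt_le_mono[OF assms(2)[of x y]] by (simp add: real_sqrt_mult)
  then show "(sqrt K)-lipschitz_on UNIV T"
    using assms(1) by (intro lipschitz_onI) (auto simp: dist_norm)
qed

text \<open>Collects what both Lipschitz bounds use about the operator; the rest of their proofs
  concerns only the vectors \<open>P\<close>, \<open>Q\<close>, \<open>D\<close> and
  \<open>x - y\<close>.\<close>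

lemma dys_differences:
  fixes f g h :: "'a::{real_inner, complete_space} \<Rightarrow> ereal"
  assumes f: "f \<in> fun_class \<mu>\<^sub>f L\<^sub>f" "0 \<le> \<mu>\<^sub>f" "ereal \<mu>\<^sub>f < L\<^sub>f"
    and g: "g \<in> fun_class \<mu>\<^sub>g L\<^sub>g" "0 \<le> \<mu>\<^sub>g" "ereal \<mu>\<^sub>g < L\<^sub>g"
    and h: "h \<in> fun_class \<mu>\<^sub>h (ereal L\<^sub>h)" "0 \<le> \<mu>\<^sub>h" "\<mu>\<^sub>h < L\<^sub>h"
    and \<alpha>: "0 < \<alpha>"
  obtains P Q D where
    "dys_operator f g h \<alpha> lam x - dys_operator f g h \<alpha> lam y = ((x - y) - lam *\<^sub>R P) + lam *\<^sub>R Q"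
    "sector (res_coeff \<alpha> L\<^sub>g) (1 / (1 + \<alpha> * \<mu>\<^sub>g)) (x - y) P"
    "sector (res_coeff \<alpha> L\<^sub>f) (1 / (1 + \<alpha> * \<mu>\<^sub>f)) (D - ((x - y) - lam *\<^sub>R P)) Q"
    "norm D \<le> max \<bar>2 - lam - \<alpha> * \<mu>\<^sub>h\<bar> \<bar>2 - lam - \<alpha> * L\<^sub>h\<bar> * norm P"
proof -
  define p where "p x = prox \<alpha> g x" for x
  define z where "z x = 2 *\<^sub>R p x - x - \<alpha> *\<^sub>R gradient h (p x)" for x
  define P Q H where "P = p x - p y" and "Q = prox \<alpha> f (z x) - prox \<alpha> f (z y)"
    and "H = gradient h (p x) - gradient h (p y)"
  \<comment> \<open>Moving \<open>lam *\<^sub>R P\<close> into \<open>A\<close> leaves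
    \<open>2 - lam\<close> here, which is why \<open>d\<close> contains that number.\<close>
  define D where "D = (2 - lam) *\<^sub>R P - \<alpha> *\<^sub>R H"
  show thesis
  proof
    show "dys_operator f g h \<alpha> lam x - dys_operator f g h \<alpha> lam y
        = ((x - y) - lam *\<^sub>R P) + lam *\<^sub>R Q"
      by (simp add: dys_operator_def P_def Q_def p_def z_def algebra_simps)
    show "sector (res_coeff \<alpha> L\<^sub>g) (1 / (1 + \<alpha> * \<mu>\<^sub>g)) (x - y) P"
      unfolding P_def p_def by (rule prox_sector[OF g \<alpha>])
    have "z x - z y = D - ((x - y) - lam *\<^sub>R P)"
      by (simp add: z_def D_def P_def H_def algebra_simps scaleR_2)
    then show "sector (res_coeff \<alpha> L\<^sub>f) (1 / (1 + \<alpha> * \<mu>\<^sub>f)) (D - ((x - y) - lam *\<^sub>R P)) Q"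
      unfolding Q_def by (metis prox_sector[OF f \<alpha>])
    have "sector \<mu>\<^sub>h L\<^sub>h P H" unfolding P_def H_def by (rule gradient_sector[OF h])
    then show "norm D \<le> max \<bar>2 - lam - \<alpha> * \<mu>\<^sub>h\<bar> \<bar>2 - lam - \<alpha> * L\<^sub>h\<bar> * norm P"
      unfolding D_def using h(3) \<alpha> by (intro sector_norm_affine_le) auto
  qed
qed

text \<open>The coefficient equals \<open>(1 - c * C) + c * R\<^sup>2 / C\<close>, a sum of two
  nonnegative terms.\<close>

lemma contraction_coefficient_nonneg:
  fixes u l c :: real
  defines "C \<equiv> 1 / 2 * (u + l)" and "R \<equiv> 1 / 2 * (u - l)"
  assumes "0 \<le> l" "l < u" "0 < c" "c < 1 / C"
  shows "0 \<le> 1 - c * ((C\<^sup>2 - R\<^sup>2) / C)"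
proof -
  have C: "0 < C" using assms by (simp add: C_def)
  have "c * ((C\<^sup>2 - R\<^sup>2) / C) = c * C - c * R\<^sup>2 / C"
    using C by (simp add: field_simps power2_eq_square)
  moreover have "c * C < 1" "0 \<le> c * R\<^sup>2 / C" using assms(5,6) C by (simp_all add: field_simps)
  ultimately show ?thesis by linarith
qed

theorem theorem1:
  fixes f g h :: "'a::{real_inner, complete_space} \<Rightarrow> ereal"
    and \<mu>\<^sub>f \<mu>\<^sub>g \<mu>\<^sub>h L\<^sub>h \<alpha> lam :: real and L\<^sub>f L\<^sub>g :: ereal
  defines "d \<equiv> max \<bar>2 - lam - \<alpha> * \<mu>\<^sub>h\<bar> \<bar>2 - lam - \<alpha> * L\<^sub>h\<bar>"
    and "C\<^sub>f \<equiv> 1 / 2 * (1 / (1 + \<alpha> * \<mu>\<^sub>f) + res_coeff \<alpha> L\<^sub>f)"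
    and "C\<^sub>g \<equiv> 1 / 2 * (1 / (1 + \<alpha> * \<mu>\<^sub>g) + res_coeff \<alpha> L\<^sub>g)"
    and "R\<^sub>f \<equiv> 1 / 2 * (1 / (1 + \<alpha> * \<mu>\<^sub>f) - res_coeff \<alpha> L\<^sub>f)"
    and "R\<^sub>g \<equiv> 1 / 2 * (1 / (1 + \<alpha> * \<mu>\<^sub>g) - res_coeff \<alpha> L\<^sub>g)"
  assumes "f \<in> fun_class \<mu>\<^sub>f L\<^sub>f" and "g \<in> fun_class \<mu>\<^sub>g L\<^sub>g" and "h \<in> fun_class \<mu>\<^sub>h (ereal L\<^sub>h)"
    and "0 \<le> \<mu>\<^sub>f" and "ereal \<mu>\<^sub>f < L\<^sub>f"
    and "0 \<le> \<mu>\<^sub>g" and "ereal \<mu>\<^sub>g < L\<^sub>g"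
    and "0 \<le> \<mu>\<^sub>h" and "\<mu>\<^sub>h < L\<^sub>h"
    and "lam > 0" and "\<alpha> > 0"
  shows "(lam < 1 / C\<^sub>f \<longrightarrow>
           (\<exists>\<rho>\<^sub>f\<ge>0.
              \<rho>\<^sub>f\<^sup>2 = (1 - lam * ((C\<^sub>f\<^sup>2 - R\<^sub>f\<^sup>2) / C\<^sub>f)) *
                max ((1 - lam / (1 + \<alpha> * \<mu>\<^sub>g))\<^sup>2
                       + lam * d\<^sup>2 / (1 / C\<^sub>f - lam) * (1 / (1 + \<alpha> * \<mu>\<^sub>g))\<^sup>2)
                    ((1 - lam * res_coeff \<alpha> L\<^sub>g)\<^sup>2
                       + lam * d\<^sup>2 / (1 / C\<^sub>f - lam) * (res_coeff \<alpha> L\<^sub>g)\<^sup>2) \<and>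
              \<rho>\<^sub>f-lipschitz_on UNIV (dys_operator f g h \<alpha> lam)))
       \<and> (lam < 1 / C\<^sub>g \<longrightarrow>
           (\<exists>\<rho>\<^sub>g\<ge>0.
              \<rho>\<^sub>g\<^sup>2 = (1 - lam * ((C\<^sub>g\<^sup>2 - R\<^sub>g\<^sup>2) / C\<^sub>g)) *
                max ((1 - lam / (1 + \<alpha> * \<mu>\<^sub>f))\<^sup>2
                       + lam * d\<^sup>2 / (1 / C\<^sub>g - lam) * (1 / (1 + \<alpha> * \<mu>\<^sub>f))\<^sup>2)
                    ((1 - lam * res_coeff \<alpha> L\<^sub>f)\<^sup>2
                       + lam * d\<^sup>2 / (1 / C\<^sub>g - lam) * (res_coeff \<alpha> L\<^sub>f)\<^sup>2) \<and>
              \<rho>\<^sub>g-lipschitz_on UNIV (dys_operator f g h \<alpha> lam)))"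
proof -
  let ?uf = "1 / (1 + \<alpha> * \<mu>\<^sub>f)" and ?ug = "1 / (1 + \<alpha> * \<mu>\<^sub>g)"
  let ?lf = "res_coeff \<alpha> L\<^sub>f" and ?lg = "res_coeff \<alpha> L\<^sub>g"
  let ?T = "dys_operator f g h \<alpha> lam"
  note diffs = dys_differences[OF assms(6,9,10,7,11,12,8,13,14,16), of lam, folded d_def]
  note lf = res_coeff_bounds[OF assms(9,10,16)]
  note lg = res_coeff_bounds[OF assms(11,12,16)]
  show ?thesis
  proof (intro conjI impI)
    assume lam: "lam < 1 / C\<^sub>f"
    \<comment> \<open>\<open>?s\<close> weighs the square of \<open>norm D\<close> in the outer
      bound; times \<open>d\<^sup>2\<close> it becomes the weight of \<open>P\<close> in the
      quadratic bound.\<close>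
    let ?\<kappa> = "1 - lam * ((C\<^sub>f\<^sup>2 - R\<^sub>f\<^sup>2) / C\<^sub>f)" and ?s = "lam / (1 / C\<^sub>f - lam)"
    let ?M = "max ((1 - lam * ?ug)\<^sup>2 + ?s * d\<^sup>2 * ?ug\<^sup>2) ((1 - lam * ?lg)\<^sup>2 + ?s * d\<^sup>2 * ?lg\<^sup>2)"
    have \<kappa>: "0 \<le> ?\<kappa>"
      using contraction_coefficient_nonneg[OF lf assms(15), folded C\<^sub>f_def R\<^sub>f_def] lam by simp
    have s: "0 \<le> ?s" using lam assms(15) by simp
    then have s': "0 \<le> ?s * d\<^sup>2" by (rule mult_nonneg_nonneg) simp
    have M: "0 \<le> ?M"
      by (intro max.coboundedI1 add_nonneg_nonneg mult_nonneg_nonneg[OF s']) simp_all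
    have "\<exists>\<rho>\<ge>0. \<rho>\<^sup>2 = ?\<kappa> * ?M \<and> \<rho>-lipschitz_on UNIV ?T"
    proof (rule lipschitz_on_sqrtI)
      show "0 \<le> ?\<kappa> * ?M" using \<kappa> M by (rule mult_nonneg_nonneg)
      fix x y
      obtain P Q D where T: "?T x - ?T y = ((x - y) - lam *\<^sub>R P) + lam *\<^sub>R Q"
        and P: "sector ?lg ?ug (x - y) P"
        and Q: "sector ?lf ?uf (D - ((x - y) - lam *\<^sub>R P)) Q" and D: "norm D \<le> d * norm P"
        using diffs by blast
      have "(norm D)\<^sup>2 \<le> (d * norm P)\<^sup>2" using D by (intro power_mono) auto
      then have "?s * (norm D)\<^sup>2 \<le> ?s * (d * norm P)\<^sup>2"
        using s by (rule mult_left_mono)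
      then have "?s * (norm D)\<^sup>2 \<le> ?s * d\<^sup>2 * (norm P)\<^sup>2"
        by (simp only: power_mult_distrib mult.assoc)
      moreover have "(norm (?T x - ?T y))\<^sup>2
          \<le> ?\<kappa> * ((norm ((x - y) - lam *\<^sub>R P))\<^sup>2 + ?s * (norm D)\<^sup>2)"
        unfolding T
        using sector_step_bound_outer[OF Q lf assms(15), folded C\<^sub>f_def R\<^sub>f_def] lam by simp
      ultimately have "(norm (?T x - ?T y))\<^sup>2
          \<le> ?\<kappa> * ((norm ((x - y) - lam *\<^sub>R P))\<^sup>2 + ?s * d\<^sup>2 * (norm P)\<^sup>2)"
        using mult_left_mono[OF _ \<kappa>] by (meson add_left_mono order_trans)
      also have "\<dots> \<le> ?\<kappa> * (?M * (norm (x - y))\<^sup>2)"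
        by (rule mult_left_mono[OF sector_quadratic_bound[OF P lg(2) s'] \<kappa>])
      finally show "(norm (?T x - ?T y))\<^sup>2 \<le> ?\<kappa> * ?M * (norm (x - y))\<^sup>2"
        by (simp only: mult.assoc)
    qed
    then show "\<exists>\<rho>\<^sub>f\<ge>0. \<rho>\<^sub>f\<^sup>2 = ?\<kappa> *
        max ((1 - lam / (1 + \<alpha> * \<mu>\<^sub>g))\<^sup>2 + lam * d\<^sup>2 / (1 / C\<^sub>f - lam) * ?ug\<^sup>2)
            ((1 - lam * ?lg)\<^sup>2 + lam * d\<^sup>2 / (1 / C\<^sub>f - lam) * ?lg\<^sup>2) \<and>
        \<rho>\<^sub>f-lipschitz_on UNIV ?T" by simp
  next
    assume lam: "lam < 1 / C\<^sub>g"
    \<comment> \<open>\<open>?e\<close> is the weight of \<open>P\<close> in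
      \<open>sector_step_bound_inner\<close>; using it in the adjoint bound lets the two estimates
      compose.\<close>
    let ?\<kappa> = "1 - lam * ((C\<^sub>g\<^sup>2 - R\<^sub>g\<^sup>2) / C\<^sub>g)" and ?e = "lam * (1 / C\<^sub>g - lam)"
    let ?M = "max ((1 - lam * ?uf)\<^sup>2 + lam\<^sup>2 * d\<^sup>2 / ?e * ?uf\<^sup>2)
      ((1 - lam * ?lf)\<^sup>2 + lam\<^sup>2 * d\<^sup>2 / ?e * ?lf\<^sup>2)"
    have \<kappa>: "0 \<le> ?\<kappa>"
      using contraction_coefficient_nonneg[OF lg assms(15), folded C\<^sub>g_def R\<^sub>g_def] lam by simp
    have e: "0 < ?e" using lam assms(15) by simp
    then have e': "0 \<le> lam\<^sup>2 * d\<^sup>2 / ?e" by simp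
    have M: "0 \<le> ?M"
      by (intro max.coboundedI1 add_nonneg_nonneg mult_nonneg_nonneg[OF e']) simp_all
    have "\<exists>\<rho>\<ge>0. \<rho>\<^sup>2 = ?\<kappa> * ?M \<and> \<rho>-lipschitz_on UNIV ?T"
    proof (rule lipschitz_on_sqrtI)
      show "0 \<le> ?\<kappa> * ?M" using \<kappa> M by (rule mult_nonneg_nonneg)
      fix x y
      obtain P Q D where T: "?T x - ?T y = ((x - y) - lam *\<^sub>R P) + lam *\<^sub>R Q"
        and P: "sector ?lg ?ug (x - y) P"
        and Q: "sector ?lf ?uf (D - ((x - y) - lam *\<^sub>R P)) Q" and D: "norm D \<le> d * norm P"
        using diffs by blast
      have "(norm (?T x - ?T y))\<^sup>2
          \<le> ?M * ((norm ((x - y) - lam *\<^sub>R P))\<^sup>2 + ?e * (norm P)\<^sup>2)"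
        unfolding T by (rule sector_step_bound_adjoint[OF Q lf(2) assms(15) e D])
      also have "\<dots> \<le> ?M * (?\<kappa> * (norm (x - y))\<^sup>2)"
        by (rule mult_left_mono[OF sector_step_bound_inner[OF P lg assms(15),
          folded C\<^sub>g_def R\<^sub>g_def] M])
      finally show "(norm (?T x - ?T y))\<^sup>2 \<le> ?\<kappa> * ?M * (norm (x - y))\<^sup>2"
        by (simp only: mult_ac)
    qed
    moreover have "lam\<^sup>2 * d\<^sup>2 / ?e = lam * d\<^sup>2 / (1 / C\<^sub>g - lam)"
      using assms(15) by (simp add: power2_eq_square)
    ultimately show "\<exists>\<rho>\<^sub>g\<ge>0. \<rho>\<^sub>g\<^sup>2 = ?\<kappa> *
        max ((1 - lam / (1 + \<alpha> * \<mu>\<^sub>f))\<^sup>2 + lam * d\<^sup>2 / (1 / C\<^sub>g - lam) * ?uf\<^sup>2)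
            ((1 - lam * ?lf)\<^sup>2 + lam * d\<^sup>2 / (1 / C\<^sub>g - lam) * ?lf\<^sup>2) \<and>
        \<rho>\<^sub>g-lipschitz_on UNIV ?T" by simp
  qed
qed

end
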